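(* Let $f:\{0,1\}^n\to\{0,1\}$ be any Boolean function and let $0\le \varepsilon<1$. Then $$\big(\mathsf{OBDD}(f)\big)^{1-\varepsilon}\;\le\;\mathsf{LV\text{-}OBDD}_{\varepsilon}(f).$$
   Context: A deterministic OBDD of width $m$ over variables $x_1,\dots,x_n$ consists of a permutation $\pi$ of $\{1,\dots,n\}$ (the variable order), a set $S$ of $m$ states, an initial state, for each step $j\in\{1,\dots,n\}$ two maps $T_j^0,T_j^1:S\to S$, and a set of accepting states. On input $x\in\{0,1\}^n$ it starts in the initial state, at step $j$ applies $T_j^{x_{\pi(j)}}$, and outputs $1$ iff the final state is accepting. (Equivalently, an oblivious leveled read-once branching program of width $m$.) $\mathsf{OBDD}(f)$ is the minimum width of a deterministic OBDD (with any order) computing $f$. A probabilistic OBDD (POBDD) of width $m$ is defined similarly, except that the initial state is a probability distribution (stochastic column vector) on $S$ and $T_j^0,T_j^1$ are $m\times m$ column-stochastic matrices; the state after step $j$ is $v_j=T_j^{x_{\pi(j)}}v_{j-1}$. A Las Vegas POBDD has $S$ partitioned into accepting, rejecting and neutral ("don't know") states; it computes $f$ with error bound $\varepsilon$ if for every input $x$ the final distribution puts probability $0$ on states giving the wrong answer (rejecting states if $f(x)=1$, accepting states if $f(x)=0$) and probability at least $1-\varepsilon$ on states giving the correct answer. $\mathsf{LV\text{-}OBDD}_{\varepsilon}(f)$ is the minimum width of a Las Vegas POBDD (any order) computing $f$ with error bound $\varepsilon$. *)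

theory Defs
  imports
    "HOL-Analysis.Analysis"
    "HOL-Combinatorics.Permutations"
    "Jordan_Normal_Form.Matrix"
begin

text \<open>
  Inputs are functions on \<open>{1..n}\<close> (extensional outside), and the bits 0 and 1 are
  \<^const>\<open>False\<close> and \<^const>\<open>True\<close>. A Boolean function on \<open>n\<close> variables is a function on
  \<open>nat \<Rightarrow> bool\<close> of which only the values on \<open>bool_cube n\<close> are used.
\<close>

definition bool_cube :: "nat \<Rightarrow> (nat \<Rightarrow> bool) set" where
  "bool_cube n = {1..n} \<rightarrow>\<^sub>E UNIV"

subsection \<open>Deterministic OBDDs\<close>

text \<open>The \<open>m\<close> states of a program of width \<open>m\<close> are the numbers in \<open>{..<m}\<close>.\<close>

record obdd =
  obdd_order :: "nat \<Rightarrow> nat"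
  obdd_init :: nat
  obdd_trans :: "nat \<Rightarrow> bool \<Rightarrow> nat \<Rightarrow> nat"
  obdd_acc :: "nat set"

definition is_obdd :: "nat \<Rightarrow> nat \<Rightarrow> obdd \<Rightarrow> bool" where
  "is_obdd n m B \<longleftrightarrow>
     obdd_order B permutes {1..n} \<and>
     obdd_init B \<in> {..<m} \<and>
     (\<forall>j\<in>{1..n}. \<forall>b. obdd_trans B j b \<in> {..<m} \<rightarrow> {..<m}) \<and>
     obdd_acc B \<subseteq> {..<m}"

primrec obdd_state :: "obdd \<Rightarrow> (nat \<Rightarrow> bool) \<Rightarrow> nat \<Rightarrow> nat" where
  "obdd_state B x 0 = obdd_init B"
| "obdd_state B x (Suc j) =
     obdd_trans B (Suc j) (x (obdd_order B (Suc j))) (obdd_state B x j)"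

definition obdd_computes :: "nat \<Rightarrow> obdd \<Rightarrow> ((nat \<Rightarrow> bool) \<Rightarrow> bool) \<Rightarrow> bool" where
  "obdd_computes n B f \<longleftrightarrow> (\<forall>x\<in>bool_cube n. f x \<longleftrightarrow> obdd_state B x n \<in> obdd_acc B)"

definition OBDD :: "nat \<Rightarrow> ((nat \<Rightarrow> bool) \<Rightarrow> bool) \<Rightarrow> nat" where
  "OBDD n f = (LEAST m. \<exists>B. is_obdd n m B \<and> obdd_computes n B f)"

subsection \<open>Las Vegas probabilistic OBDDs\<close>

definition stochastic_vec :: "nat \<Rightarrow> real vec \<Rightarrow> bool" where
  "stochastic_vec m v \<longleftrightarrow>
     v \<in> carrier_vec m \<and> (\<forall>i<m. 0 \<le> vec_index v i) \<and> (\<Sum>i<m. vec_index v i) = 1"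

definition column_stochastic_mat :: "nat \<Rightarrow> real mat \<Rightarrow> bool" where
  "column_stochastic_mat m A \<longleftrightarrow>
     A \<in> carrier_mat m m \<and> (\<forall>k<m. stochastic_vec m (col A k))"

record pobdd =
  pobdd_order :: "nat \<Rightarrow> nat"
  pobdd_init :: "real vec"
  pobdd_trans :: "nat \<Rightarrow> bool \<Rightarrow> real mat"

record lv_pobdd = pobdd +
  lv_acc :: "nat set"
  lv_rej :: "nat set"
  lv_neutral :: "nat set"

definition is_pobdd :: "nat \<Rightarrow> nat \<Rightarrow> 'a pobdd_scheme \<Rightarrow> bool" where
  "is_pobdd n m P \<longleftrightarrow>
     pobdd_order P permutes {1..n} \<and>
     stochastic_vec m (pobdd_init P) \<and>
     (\<forall>j\<in>{1..n}. \<forall>b. column_stochastic_mat m (pobdd_trans P j b))"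

text \<open>The three classes of states are pairwise disjoint and cover the state set, but any of
  them may be empty.\<close>

definition is_lv_pobdd :: "nat \<Rightarrow> nat \<Rightarrow> lv_pobdd \<Rightarrow> bool" where
  "is_lv_pobdd n m P \<longleftrightarrow>
     is_pobdd n m P \<and>
     lv_acc P \<union> lv_rej P \<union> lv_neutral P = {..<m} \<and>
     lv_acc P \<inter> lv_rej P = {} \<and>
     lv_acc P \<inter> lv_neutral P = {} \<and>
     lv_rej P \<inter> lv_neutral P = {}"

primrec pobdd_dist :: "'a pobdd_scheme \<Rightarrow> (nat \<Rightarrow> bool) \<Rightarrow> nat \<Rightarrow> real vec" where
  "pobdd_dist P x 0 = pobdd_init P"
| "pobdd_dist P x (Suc j) =
     pobdd_trans P (Suc j) (x (pobdd_order P (Suc j))) *\<^sub>v pobdd_dist P x j"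

definition pobdd_prob :: "nat \<Rightarrow> 'a pobdd_scheme \<Rightarrow> (nat \<Rightarrow> bool) \<Rightarrow> nat set \<Rightarrow> real" where
  "pobdd_prob n P x A = (\<Sum>i\<in>A. vec_index (pobdd_dist P x n) i)"

definition lv_computes ::
    "nat \<Rightarrow> real \<Rightarrow> lv_pobdd \<Rightarrow> ((nat \<Rightarrow> bool) \<Rightarrow> bool) \<Rightarrow> bool" where
  "lv_computes n \<epsilon> P f \<longleftrightarrow>
     (\<forall>x\<in>bool_cube n.
        (f x \<longrightarrow> pobdd_prob n P x (lv_rej P) = 0 \<and> pobdd_prob n P x (lv_acc P) \<ge> 1 - \<epsilon>) \<and>
        (\<not> f x \<longrightarrow> pobdd_prob n P x (lv_acc P) = 0 \<and> pobdd_prob n P x (lv_rej P) \<ge> 1 - \<epsilon>))"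

definition LV_OBDD :: "nat \<Rightarrow> real \<Rightarrow> ((nat \<Rightarrow> bool) \<Rightarrow> bool) \<Rightarrow> nat" where
  "LV_OBDD n \<epsilon> f = (LEAST m. \<exists>P. is_lv_pobdd n m P \<and> lv_computes n \<epsilon> P f)"

end

theory Submission
  imports Defs
begin

text \<open>
  Fix a level of a Las Vegas program of width \<open>m\<close>. Let \<open>N\<close> be the number of subfunctions of \<open>f\<close>
  obtained by fixing the variables read so far; the maximum of \<open>N\<close> over the levels is the
  deterministic width for the same variable order, so it suffices to show \<open>N powr (1 - \<epsilon>) \<le> m\<close>.
  Choose one prefix \<open>a\<close> for each subfunction and let \<open>p a\<close> be the distribution of the state after
  reading it. Distinct prefixes are told apart by some suffix, so a binary decision tree whose
  nodes are labelled by suffixes separates all \<open>N\<close> prefixes. Every state \<open>s\<close> yields a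
  subprobability \<open>q s\<close> on the leaves of the tree: at a node whose suffix may lead \<open>s\<close> to a
  definite answer, all mass follows that answer (zero error makes it correct), and at every other
  node the mass is split in proportion to the numbers of leaves. The latter nodes are met with
  probability at most \<open>\<epsilon>\<close> under \<open>p a\<close>, so the \<open>p a\<close>-average of \<open>ln (q s a)\<close> is at least
  \<open>- \<epsilon> * ln N\<close>. By concavity of the logarithm, \<open>N powr (- \<epsilon>) \<le> (\<Sum>s. q s a)\<close>, and summation over
  \<open>a\<close> gives the claim.
\<close>

section \<open>Families of distributions with Las Vegas tests\<close>

text \<open>
  In the separation hypothesis, \<open>g c\<close> is the answer for \<open>c\<close> to a binary test and \<open>K v s\<close> says that
  state \<open>s\<close> may announce the answer \<open>v\<close>.
\<close>

lemma las_vegas_posterior: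
  fixes p :: "'a \<Rightarrow> 's \<Rightarrow> real"
  assumes "finite X" and "X \<noteq> {}" and S: "finite S" and eps: "0 \<le> \<epsilon>"
    and nonneg: "\<And>a s. a \<in> X \<Longrightarrow> s \<in> S \<Longrightarrow> 0 \<le> p a s"
    and sep: "\<And>a b. a \<in> X \<Longrightarrow> b \<in> X \<Longrightarrow> a \<noteq> b \<Longrightarrow>
      \<exists>g K. g a \<noteq> g b \<and> (\<forall>c\<in>X. (\<Sum>s\<in>{s\<in>S. \<not> K (g c) s}. p c s) \<le> \<epsilon> \<and>
        (\<forall>s\<in>S. K (\<not> g c) s \<longrightarrow> p c s = 0))"
  shows "\<exists>q. (\<forall>s\<in>S. \<forall>a\<in>X. 0 \<le> q s a) \<and> (\<forall>s\<in>S. (\<Sum>a\<in>X. q s a) \<le> 1) \<and>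
    (\<forall>a\<in>X. \<forall>s\<in>S. 0 < p a s \<longrightarrow> 0 < q s a) \<and>
    (\<forall>a\<in>X. - \<epsilon> * ln (card X) \<le> (\<Sum>s\<in>S. p a s * ln (q s a)))"
  using assms(1,2) nonneg sep
proof (induction X rule: finite_psubset_induct)
  case (psubset X)
  show ?case
  proof (cases "\<exists>a\<in>X. \<exists>b\<in>X. a \<noteq> b")
    case False
    then obtain a where "X = {a}"
      using psubset.prems(1) by blast
    \<comment> \<open>A single prefix needs no test: the constant 1 has total mass 1, and both sides
      of the logarithmic bound are 0.\<close>
    then show ?thesis
      by (intro exI[of _ "\<lambda>_ _. 1"]) simp
  next
    case True
    then obtain a b where ab: "a \<in> X" "b \<in> X" "a \<noteq> b" by blast
    obtain g K where gK: "g a \<noteq> g b \<and> (\<forall>c\<in>X. (\<Sum>s\<in>{s\<in>S. \<not> K (g c) s}. p c s) \<le> \<epsilon> \<and>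
        (\<forall>s\<in>S. K (\<not> g c) s \<longrightarrow> p c s = 0))"
      using psubset.prems(3)[OF ab] by (elim exE) (rule that)
    have g: "g a \<noteq> g b" using gK by blast
    have K: "(\<Sum>s\<in>{s\<in>S. \<not> K (g c) s}. p c s) \<le> \<epsilon>" if "c \<in> X" for c
      using gK that by blast
    have K0: "p c s = 0" if "c \<in> X" "s \<in> S" "K (\<not> g c) s" for c s
      using gK that by blast
    \<comment> \<open>The answers to the test split \<open>X\<close> into two subtrees. Both are
      nonempty and proper, since \<open>a\<close> and \<open>b\<close> are answered differently, so
      induction applies to each.\<close>
    define Y where "Y v = {c\<in>X. g c = v}" for v
    have Y_psub: "Y v \<subset> X" for v
      using ab g by (cases "g a"; cases v) (auto simp: Y_def)
    have Y_ne: "Y v \<noteq> {}" for v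
      using ab g by (cases "g a"; cases v) (auto simp: Y_def)
    have Y_sub: "c \<in> Y v \<Longrightarrow> c \<in> X" for c v by (simp add: Y_def)
    have fin: "finite (Y v)" for v
      using psubset.hyps Y_psub[of v] finite_subset by blast
    have "\<forall>v. \<exists>q. (\<forall>s\<in>S. \<forall>a\<in>Y v. 0 \<le> q s a) \<and> (\<forall>s\<in>S. (\<Sum>a\<in>Y v. q s a) \<le> 1) \<and>
      (\<forall>a\<in>Y v. \<forall>s\<in>S. 0 < p a s \<longrightarrow> 0 < q s a) \<and>
      (\<forall>a\<in>Y v. - \<epsilon> * ln (card (Y v)) \<le> (\<Sum>s\<in>S. p a s * ln (q s a)))"
    proof
      fix v
      show "\<exists>q. (\<forall>s\<in>S. \<forall>a\<in>Y v. 0 \<le> q s a) \<and> (\<forall>s\<in>S. (\<Sum>a\<in>Y v. q s a) \<le> 1) \<and>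
        (\<forall>a\<in>Y v. \<forall>s\<in>S. 0 < p a s \<longrightarrow> 0 < q s a) \<and>
        (\<forall>a\<in>Y v. - \<epsilon> * ln (card (Y v)) \<le> (\<Sum>s\<in>S. p a s * ln (q s a)))"
      proof (rule psubset.IH[OF Y_psub Y_ne])
        show "0 \<le> p a s" if "a \<in> Y v" "s \<in> S" for a s
          using psubset.prems(2) Y_sub that by blast
        show "\<exists>g K. g a \<noteq> g b \<and> (\<forall>c\<in>Y v. (\<Sum>s\<in>{s\<in>S. \<not> K (g c) s}. p c s) \<le> \<epsilon> \<and>
          (\<forall>s\<in>S. K (\<not> g c) s \<longrightarrow> p c s = 0))" if ab: "a \<in> Y v" "b \<in> Y v" "a \<noteq> b" for a b
        proof -
          obtain g K where "g a \<noteq> g b \<and> (\<forall>c\<in>X. (\<Sum>s\<in>{s\<in>S. \<not> K (g c) s}. p c s) \<le> \<epsilon> \<and>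
              (\<forall>s\<in>S. K (\<not> g c) s \<longrightarrow> p c s = 0))"
            using psubset.prems(3)[OF Y_sub[OF ab(1)] Y_sub[OF ab(2)] ab(3)]
            by (elim exE) (rule that)
          then show ?thesis
            using Y_sub by (intro exI[of _ g] exI[of _ K]) blast
        qed
      qed
    qed
    from choice[OF this] obtain q where q: "\<forall>v. (\<forall>s\<in>S. \<forall>a\<in>Y v. 0 \<le> q v s a) \<and>
      (\<forall>s\<in>S. (\<Sum>a\<in>Y v. q v s a) \<le> 1) \<and>
      (\<forall>a\<in>Y v. \<forall>s\<in>S. 0 < p a s \<longrightarrow> 0 < q v s a) \<and>
      (\<forall>a\<in>Y v. - \<epsilon> * ln (card (Y v)) \<le> (\<Sum>s\<in>S. p a s * ln (q v s a)))"
      by (elim exE) (rule that)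
    \<comment> \<open>The share of each subtree in the leaves. With this choice
      \<open>\<epsilon> * ln (r v)\<close> is exactly the gap between the bounds for
      \<open>Y v\<close> and for \<open>X\<close>.\<close>
    define r where "r v = real (card (Y v)) / card X" for v
    have cardX: "card X > 0"
      using psubset by (simp add: card_gt_0_iff)
    have cardY: "card (Y v) > 0" for v
      using fin Y_ne by (simp add: card_gt_0_iff)
    have r_pos: "0 < r v" for v
      using cardX cardY by (simp add: r_def)
    have X_split: "X = Y True \<union> Y False" "Y True \<inter> Y False = {}"
      by (auto simp: Y_def)
    have "card X = card (Y True) + card (Y False)"
      using X_split fin card_Un_disjoint by metis
    then have r_sum: "r True + r False = 1"
      using cardX by (simp add: r_def flip: add_divide_distrib of_nat_add)
    then have r_le: "r v \<le> 1" for v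
      using r_pos[of "\<not> v"] by (cases v) auto
    \<comment> \<open>If \<open>s\<close> may announce \<open>\<not> v\<close>, no prefix with
      answer \<open>v\<close> reaches \<open>s\<close>, so weight 0 loses nothing. If
      \<open>s\<close> may announce both answers, both weights are 0; hence only subprobabilities
      arise.\<close>
    define w where "w v s = (if K (\<not> v) s then 0 else if K v s then 1 else r v)" for v s
    have w_nonneg: "0 \<le> w v s" for v s
      using r_pos[of v] by (simp add: w_def)
    have w_sum: "w True s + w False s \<le> 1" for s
      using r_sum by (simp add: w_def)
    define Q where "Q s c = w (g c) s * q (g c) s c" for s c
    have 1: "0 \<le> Q s c" if "s \<in> S" "c \<in> X" for s c
    proof -
      have "c \<in> Y (g c)" using that by (simp add: Y_def)
      then show ?thesis using q w_nonneg that by (simp add: Q_def)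
    qed
    have 2: "(\<Sum>c\<in>X. Q s c) \<le> 1" if "s \<in> S" for s
    proof -
      have part: "(\<Sum>c\<in>Y v. Q s c) \<le> w v s" for v
      proof -
        have "(\<Sum>c\<in>Y v. Q s c) = w v s * (\<Sum>c\<in>Y v. q v s c)"
          unfolding sum_distrib_left by (rule sum.cong) (auto simp: Q_def Y_def)
        also have "\<dots> \<le> w v s * 1"
          using q that w_nonneg by (intro mult_left_mono) auto
        finally show ?thesis by simp
      qed
      have "(\<Sum>c\<in>X. Q s c) = (\<Sum>c\<in>Y True. Q s c) + (\<Sum>c\<in>Y False. Q s c)"
        by (subst X_split(1)) (rule sum.union_disjoint[OF fin fin X_split(2)])
      also have "\<dots> \<le> 1"
        using part[of True] part[of False] w_sum[of s] by linarith
      finally show ?thesis .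
    qed
    have 3: "0 < Q s c" if "c \<in> X" "s \<in> S" "0 < p c s" for s c
    proof -
      have "c \<in> Y (g c)" using that by (simp add: Y_def)
      moreover have "0 < w (g c) s"
        using K0[of c s] that r_pos by (auto simp: w_def)
      ultimately show ?thesis using q that by (simp add: Q_def)
    qed
    have 4: "- \<epsilon> * ln (card X) \<le> (\<Sum>s\<in>S. p c s * ln (Q s c))" if c: "c \<in> X" for c
    proof -
      let ?v = "g c"
      have cY: "c \<in> Y ?v" using c by (simp add: Y_def)
      \<comment> \<open>Positive mass at \<open>s\<close> excludes the weight 0, so the factor is 1
        or \<open>r ?v\<close>, and only the latter adds to the logarithm. Where
        \<open>p c s\<close> is 0, the value of \<open>ln\<close> does not matter.\<close>
      have term_eq: "p c s * ln (Q s c) =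
        p c s * ln (q ?v s c) + (if \<not> K ?v s then p c s * ln (r ?v) else 0)" if s: "s \<in> S" for s
      proof (cases "p c s = 0")
        case False
        then have "0 < p c s" using psubset.prems(2)[OF c s] by simp
        then have "0 < q ?v s c" using q cY s by blast
        moreover have "\<not> K (\<not> ?v) s" using K0[OF c s] False by blast
        ultimately show ?thesis
          using r_pos[of ?v] by (simp add: Q_def w_def ln_mult algebra_simps)
      qed simp
      have "- \<epsilon> * ln (card X) = - \<epsilon> * ln (card (Y ?v)) + \<epsilon> * ln (r ?v)"
        using cardX cardY[of ?v] by (simp add: r_def ln_div algebra_simps)
      \<comment> \<open>The undecided states have mass at most \<open>\<epsilon>\<close>;
        multiplying by \<open>ln (r ?v) \<le> 0\<close> reverses this inequality.\<close>
      also have "\<dots> \<le> (\<Sum>s\<in>S. p c s * ln (q ?v s c)) +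
          (\<Sum>s\<in>{s\<in>S. \<not> K ?v s}. p c s) * ln (r ?v)"
        using q cY K[OF c] r_pos[of ?v] r_le[of ?v]
        by (intro add_mono mult_right_mono_neg) auto
      also have "\<dots> = (\<Sum>s\<in>S. p c s * ln (Q s c))"
        using S by (simp only: sum.inter_filter[symmetric] sum_distrib_right sum.distrib term_eq
          cong: sum.cong)
      finally show ?thesis .
    qed
    show ?thesis
      using 1 2 3 4 by (intro exI[of _ Q]) blast
  qed
qed

text \<open>The total of all \<open>q s a\<close> is counted twice: each state contributes at most
  1, and each element of \<open>X\<close> receives at least
  \<open>card X powr (- \<epsilon>)\<close>.\<close>

lemma las_vegas_card_bound:
  fixes p :: "'a \<Rightarrow> 's \<Rightarrow> real"
  assumes X: "finite X" "X \<noteq> {}" and S: "finite S" and eps: "0 \<le> \<epsilon>"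
    and nonneg: "\<And>a s. a \<in> X \<Longrightarrow> s \<in> S \<Longrightarrow> 0 \<le> p a s"
    and sum1: "\<And>a. a \<in> X \<Longrightarrow> (\<Sum>s\<in>S. p a s) = 1"
    and sep: "\<And>a b. a \<in> X \<Longrightarrow> b \<in> X \<Longrightarrow> a \<noteq> b \<Longrightarrow>
      \<exists>g K. g a \<noteq> g b \<and> (\<forall>c\<in>X. (\<Sum>s\<in>{s\<in>S. \<not> K (g c) s}. p c s) \<le> \<epsilon> \<and>
        (\<forall>s\<in>S. K (\<not> g c) s \<longrightarrow> p c s = 0))"
  shows "real (card X) powr (1 - \<epsilon>) \<le> card S"
proof -
  have "\<exists>q. (\<forall>s\<in>S. \<forall>a\<in>X. 0 \<le> q s a) \<and> (\<forall>s\<in>S. (\<Sum>a\<in>X. q s a) \<le> 1) \<and>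
    (\<forall>a\<in>X. \<forall>s\<in>S. 0 < p a s \<longrightarrow> 0 < q s a) \<and>
    (\<forall>a\<in>X. - \<epsilon> * ln (card X) \<le> (\<Sum>s\<in>S. p a s * ln (q s a)))"
    by (rule las_vegas_posterior) (fact X S eps nonneg sep)+
  then obtain q where q_nonneg: "\<forall>s\<in>S. \<forall>a\<in>X. 0 \<le> q s a"
    and q_sum: "\<forall>s\<in>S. (\<Sum>a\<in>X. q s a) \<le> 1"
    and q_pos: "\<forall>a\<in>X. \<forall>s\<in>S. 0 < p a s \<longrightarrow> 0 < q s a"
    and q_ln: "\<forall>a\<in>X. - \<epsilon> * ln (card X) \<le> (\<Sum>s\<in>S. p a s * ln (q s a))"
    by (elim exE conjE) (rule that)
  have cardX: "0 < card X"
    using X by (simp add: card_gt_0_iff)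
  define t where "t = real (card X) powr (- \<epsilon>)"
  have t_pos: "0 < t" and ln_t: "ln t = - \<epsilon> * ln (card X)"
    using cardX by (simp_all add: t_def ln_powr)
  have lower: "t \<le> (\<Sum>s\<in>S. q s a)" if a: "a \<in> X" for a
  proof -
    have "0 \<le> (\<Sum>s\<in>S. p a s * ln (q s a)) - (\<Sum>s\<in>S. p a s) * ln t"
      using bspec[OF q_ln a] sum1[OF a] ln_t by simp
    also have "\<dots> = (\<Sum>s\<in>S. p a s * (ln (q s a) - ln t))"
      by (simp add: sum_distrib_right right_diff_distrib sum_subtractf)
    \<comment> \<open>Instead of Jensen's inequality, the tangent bound
      \<open>ln u \<le> u - 1\<close> is used at \<open>u = q s a / t\<close>; states with
      \<open>p a s = 0\<close> drop out.\<close>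
    also have "\<dots> \<le> (\<Sum>s\<in>S. p a s * (q s a / t - 1))"
    proof (rule sum_mono)
      fix s assume s: "s \<in> S"
      show "p a s * (ln (q s a) - ln t) \<le> p a s * (q s a / t - 1)"
      proof (cases "p a s = 0")
        case False
        then have "0 < p a s" using nonneg[OF a s] by simp
        moreover from this have "0 < q s a" using q_pos a s by blast
        ultimately show ?thesis
          using t_pos ln_le_minus_one[of "q s a / t"]
          by (intro mult_left_mono) (simp_all add: ln_div)
      qed simp
    qed
    also have "\<dots> = (\<Sum>s\<in>S. p a s * q s a) / t - 1"
      using sum1[OF a] by (simp add: right_diff_distrib sum_subtractf sum_divide_distrib)
    finally have "t \<le> (\<Sum>s\<in>S. p a s * q s a)"
      using t_pos by (simp add: field_simps)
    \<comment> \<open>Dropping the weights removes the dependence on \<open>p a\<close>, so that the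
      sums over \<open>a\<close> and \<open>s\<close> can be exchanged below.\<close>
    also have "\<dots> \<le> (\<Sum>s\<in>S. 1 * q s a)"
    proof (intro sum_mono mult_right_mono)
      fix s assume s: "s \<in> S"
      show "p a s \<le> 1"
        using member_le_sum[OF s, of "p a"] nonneg[OF a] S sum1[OF a] by auto
      show "0 \<le> q s a" using q_nonneg s a by blast
    qed
    finally show ?thesis by simp
  qed
  have "real (card X) powr (1 - \<epsilon>) = (\<Sum>a\<in>X. t)"
    using cardX by (simp add: t_def powr_diff powr_minus_divide)
  also have "\<dots> \<le> (\<Sum>a\<in>X. \<Sum>s\<in>S. q s a)"
    using lower by (rule sum_mono)
  also have "\<dots> = (\<Sum>s\<in>S. \<Sum>a\<in>X. q s a)"
    by (rule sum.swap)
  also have "\<dots> \<le> (\<Sum>s\<in>S. 1)"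
    using q_sum by (intro sum_mono) auto
  finally show ?thesis by simp
qed

section \<open>Subfunctions and deterministic width\<close>

definition mix :: "(nat \<Rightarrow> nat) \<Rightarrow> nat \<Rightarrow> (nat \<Rightarrow> bool) \<Rightarrow> (nat \<Rightarrow> bool) \<Rightarrow> nat \<Rightarrow> bool" where
  "mix \<pi> j x y = (\<lambda>i. if i \<in> \<pi> ` {1..j} then x i else y i)"

text \<open>A subfunction is encoded as its set of accepted inputs. Letting \<open>y\<close> range
  over the whole cube avoids partial assignments, as \<open>mix\<close> ignores its bits at
  variables already read.\<close>

definition subfunction ::
    "nat \<Rightarrow> ((nat \<Rightarrow> bool) \<Rightarrow> bool) \<Rightarrow> (nat \<Rightarrow> nat) \<Rightarrow> nat \<Rightarrow> (nat \<Rightarrow> bool) \<Rightarrow> (nat \<Rightarrow> bool) set" where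
  "subfunction n f \<pi> j x = {y \<in> bool_cube n. f (mix \<pi> j x y)}"

lemma bool_cube_eq_extensional: "bool_cube n = extensional {1..n}"
  by (simp add: bool_cube_def PiE_def)

lemma finite_bool_cube: "finite (bool_cube n)"
  by (simp add: bool_cube_def finite_PiE)

lemma bool_cube_nonempty: "bool_cube n \<noteq> {}"
  by (simp add: bool_cube_def PiE_eq_empty_iff)

lemma mix_in_bool_cube: "x \<in> bool_cube n \<Longrightarrow> y \<in> bool_cube n \<Longrightarrow> mix \<pi> j x y \<in> bool_cube n"
  by (simp add: bool_cube_eq_extensional extensional_def mix_def)

lemma upd_in_bool_cube: "x \<in> bool_cube n \<Longrightarrow> i \<in> {1..n} \<Longrightarrow> x(i := b) \<in> bool_cube n"
  by (auto simp: bool_cube_eq_extensional extensional_def)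

lemma mix_Suc_upd:
  assumes "\<pi> permutes {1..n}"
  shows "mix \<pi> (Suc j) (x(\<pi> (Suc j) := b)) y = mix \<pi> j x (y(\<pi> (Suc j) := b))"
proof -
  have "inj \<pi>" using assms permutes_inj by blast
  then have "\<pi> (Suc j) \<notin> \<pi> ` {1..j}" by (simp add: inj_image_mem_iff)
  moreover have "\<pi> ` {1..Suc j} = insert (\<pi> (Suc j)) (\<pi> ` {1..j})"
    by (simp add: atLeastAtMostSuc_conv)
  ultimately show ?thesis by (auto simp: mix_def fun_eq_iff)
qed

lemma mix_full:
  assumes "\<pi> permutes {1..n}" "x \<in> bool_cube n" "y \<in> bool_cube n"
  shows "mix \<pi> n x y = x"
proof
  fix i
  have "x i = y i" if "i \<notin> {1..n}"
    using extensional_arb[of _ "{1..n}" i] that assms(2,3)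
    unfolding bool_cube_eq_extensional by metis
  then show "mix \<pi> n x y i = x i"
    unfolding mix_def permutes_image[OF assms(1)] by metis
qed

text \<open>This makes the transitions of the subfunction automaton well defined: reading a bit
  restricts the current subfunction, whichever prefix produced it.\<close>

lemma subfunction_Suc_cong:
  assumes "\<pi> permutes {1..n}" "Suc j \<le> n" "subfunction n f \<pi> j x = subfunction n f \<pi> j x'"
  shows "subfunction n f \<pi> (Suc j) (x(\<pi> (Suc j) := b)) =
    subfunction n f \<pi> (Suc j) (x'(\<pi> (Suc j) := b))"
proof -
  have "\<pi> (Suc j) \<in> {1..n}"
    using assms permutes_in_image[of \<pi> "{1..n}" "Suc j"] by simp
  then have "f (mix \<pi> j x (y(\<pi> (Suc j) := b))) = f (mix \<pi> j x' (y(\<pi> (Suc j) := b)))"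
    if "y \<in> bool_cube n" for y
    using assms(3) upd_in_bool_cube[OF that] by (auto simp: subfunction_def set_eq_iff)
  then show ?thesis
    unfolding subfunction_def mix_Suc_upd[OF assms(1)] by blast
qed

text \<open>A Myhill-Nerode construction by levels: the state after step \<open>j\<close> is a
  number for the current subfunction, and the same \<open>M\<close> numbers are reused at every
  level.\<close>

lemma obdd_of_subfunctions:
  assumes \<pi>: "\<pi> permutes {1..n}"
    and card: "\<And>j. j \<le> n \<Longrightarrow> card (subfunction n f \<pi> j ` bool_cube n) \<le> M"
  shows "\<exists>B. is_obdd n M B \<and> obdd_computes n B f"
proof -
  let ?sub = "subfunction n f \<pi>"
  let ?Q = "\<lambda>j. ?sub j ` bool_cube n"
  have "\<forall>j. \<exists>e. j \<le> n \<longrightarrow> inj_on e (?Q j) \<and> e ` ?Q j \<subseteq> {..<M}"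
  proof
    fix j
    show "\<exists>e. j \<le> n \<longrightarrow> inj_on e (?Q j) \<and> e ` ?Q j \<subseteq> {..<M}"
    proof (cases "j \<le> n")
      case True
      then show ?thesis
        using card_le_inj[of "?Q j" "{..<M}"] card[OF True] finite_bool_cube by fastforce
    qed simp
  qed
  then obtain e where e_inj: "\<And>j. j \<le> n \<Longrightarrow> inj_on (e j) (?Q j)"
    and e_ran: "\<And>j. j \<le> n \<Longrightarrow> e j ` ?Q j \<subseteq> {..<M}"
    by metis
  obtain x0 where x0: "x0 \<in> bool_cube n" using bool_cube_nonempty by blast
  \<comment> \<open>\<open>rep j\<close> decodes a number into a prefix with that subfunction. The
    default \<open>x0\<close> keeps the transitions total on numbers that encode nothing at this
    level.\<close>
  define rep where "rep j k = (if k \<in> e j ` ?Q j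
    then SOME x. x \<in> bool_cube n \<and> e j (?sub j x) = k else x0)" for j k
  have rep_cube: "rep j k \<in> bool_cube n" for j k
  proof (cases "k \<in> e j ` ?Q j")
    case True
    then have "\<exists>x. x \<in> bool_cube n \<and> e j (?sub j x) = k" by blast
    from someI_ex[OF this] show ?thesis using True by (simp add: rep_def)
  qed (use x0 in \<open>simp add: rep_def\<close>)
  have rep_sub: "?sub j (rep j (e j (?sub j x))) = ?sub j x"
    if "j \<le> n" and x: "x \<in> bool_cube n" for j x
  proof -
    have "\<exists>z. z \<in> bool_cube n \<and> e j (?sub j z) = e j (?sub j x)" using x by blast
    from someI_ex[OF this] have "e j (?sub j (rep j (e j (?sub j x)))) = e j (?sub j x)"
      using x by (simp add: rep_def)
    then show ?thesis
      using e_inj[OF that(1)] rep_cube x by (auto dest: inj_onD)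
  qed
  \<comment> \<open>Step \<open>j\<close> decodes its source at level \<open>j - 1\<close>. Before
    any reading all inputs give the same subfunction, so \<open>x0\<close> serves for the initial
    state.\<close>
  define B where "B = \<lparr> obdd_order = \<pi>, obdd_init = e 0 (?sub 0 x0),
    obdd_trans = (\<lambda>j b k. e j (?sub j ((rep (j - 1) k)(\<pi> j := b)))),
    obdd_acc = e n ` ?sub n ` {x \<in> bool_cube n. f x} \<rparr>"
  have "is_obdd n M B"
  proof -
    have "\<pi> j \<in> {1..n}" if "j \<in> {1..n}" for j
      using \<pi> that permutes_in_image by metis
    then have "(rep (j - 1) k)(\<pi> j := b) \<in> bool_cube n" if "j \<in> {1..n}" for j b k
      using that rep_cube upd_in_bool_cube by blast
    then have "e j (?sub j ((rep (j - 1) k)(\<pi> j := b))) \<in> {..<M}" if "j \<in> {1..n}" for j b k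
      using e_ran[of j] that by (meson atLeastAtMost_iff imageI subsetD)
    moreover have "e 0 (?sub 0 x0) \<in> {..<M}"
      using e_ran[of 0] x0 by blast
    moreover have "e n ` ?sub n ` {x \<in> bool_cube n. f x} \<subseteq> {..<M}"
      using e_ran[of n] by blast
    ultimately show ?thesis
      using \<pi> by (simp add: is_obdd_def B_def)
  qed
  moreover have "obdd_computes n B f"
  proof -
    have state: "obdd_state B x j = e j (?sub j x)" if "x \<in> bool_cube n" "j \<le> n" for x j
      using that(2)
    proof (induction j)
      case 0
      then show ?case by (simp add: B_def subfunction_def mix_def)
    next
      case (Suc j)
      \<comment> \<open>Writing the bit of \<open>x\<close> into \<open>x\<close> itself changes
        nothing, so the right-hand side is the subfunction of \<open>x\<close> at the next
        level.\<close>
      have "?sub (Suc j) ((rep j (e j (?sub j x)))(\<pi> (Suc j) := x (\<pi> (Suc j)))) =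
          ?sub (Suc j) (x(\<pi> (Suc j) := x (\<pi> (Suc j))))"
        using Suc.prems rep_sub that(1) by (intro subfunction_Suc_cong[OF \<pi>]) auto
      then show ?case
        using Suc by (simp add: B_def)
    qed
    \<comment> \<open>After the last step the subfunction is the whole cube or empty, so its number
      determines \<open>f x\<close>.\<close>
    have sub_n: "?sub n x = {y \<in> bool_cube n. f x}" if "x \<in> bool_cube n" for x
      using mix_full[OF \<pi> that] by (auto simp: subfunction_def)
    have "f x \<longleftrightarrow> e n (?sub n x) \<in> e n ` ?sub n ` {x \<in> bool_cube n. f x}"
      if x: "x \<in> bool_cube n" for x
    proof
      assume "e n (?sub n x) \<in> e n ` ?sub n ` {x \<in> bool_cube n. f x}"
      then obtain z where z: "z \<in> bool_cube n" "f z" "e n (?sub n x) = e n (?sub n z)" by blast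
      then have "?sub n x = ?sub n z"
        using e_inj[of n] x by (auto dest: inj_onD)
      then show "f x" using sub_n x z by auto
    qed (use x in blast)
    then show ?thesis
      using state by (simp add: obdd_computes_def) (simp add: B_def)
  qed
  ultimately show ?thesis by blast
qed

section \<open>Las Vegas programs\<close>

lemma stochastic_mult_mat_vec:
  assumes A: "column_stochastic_mat m A" and v: "stochastic_vec m v"
  shows "stochastic_vec m (A *\<^sub>v v)"
proof -
  have [simp]: "dim_row A = m" "dim_col A = m" "dim_vec v = m"
    using A v by (auto simp: column_stochastic_mat_def stochastic_vec_def)
  have ent: "0 \<le> A $$ (i, k)" if "i < m" "k < m" for i k
    using A that by (auto simp: column_stochastic_mat_def stochastic_vec_def)
  have cs: "(\<Sum>i<m. A $$ (i, k)) = 1" if "k < m" for k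
    using A that by (auto simp: column_stochastic_mat_def stochastic_vec_def)
  have vn: "0 \<le> vec_index v k" if "k < m" for k
    using v that by (auto simp: stochastic_vec_def)
  have idx: "vec_index (A *\<^sub>v v) i = (\<Sum>k<m. A $$ (i, k) * vec_index v k)" if "i < m" for i
    using that by (simp add: scalar_prod_def lessThan_atLeast0)
  have "(\<Sum>i<m. vec_index (A *\<^sub>v v) i) = (\<Sum>i<m. \<Sum>k<m. A $$ (i, k) * vec_index v k)"
    using idx by simp
  also have "\<dots> = (\<Sum>k<m. \<Sum>i<m. A $$ (i, k) * vec_index v k)"
    by (rule sum.swap)
  also have "\<dots> = (\<Sum>k<m. vec_index v k)"
    using cs by (simp flip: sum_distrib_right)
  also have "\<dots> = 1"
    using v by (simp add: stochastic_vec_def)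
  finally have "(\<Sum>i<m. vec_index (A *\<^sub>v v) i) = 1" .
  moreover have "0 \<le> vec_index (A *\<^sub>v v) i" if "i < m" for i
    unfolding idx[OF that] using ent vn that by (intro sum_nonneg) auto
  moreover have "A *\<^sub>v v \<in> carrier_vec m"
    by (intro carrier_vecI) simp
  ultimately show ?thesis
    unfolding stochastic_vec_def by blast
qed

lemma column_stochastic_mult:
  assumes A: "column_stochastic_mat m A" and B: "column_stochastic_mat m B"
  shows "column_stochastic_mat m (A * B)"
proof -
  have carr: "A \<in> carrier_mat m m" "B \<in> carrier_mat m m"
    using A B by (auto simp: column_stochastic_mat_def)
  have "stochastic_vec m (col (A * B) k)" if "k < m" for k
    using stochastic_mult_mat_vec[OF A, of "col B k"] B that carr col_mult2[OF carr]
    by (simp add: column_stochastic_mat_def)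
  then show ?thesis
    using carr by (simp add: column_stochastic_mat_def)
qed

lemma stochastic_unit_vec: "i < m \<Longrightarrow> stochastic_vec m (unit_vec m i)"
  by (simp add: stochastic_vec_def unit_vec_def)

lemma column_stochastic_one: "column_stochastic_mat m (1\<^sub>m m)"
  by (simp add: column_stochastic_mat_def stochastic_unit_vec)

text \<open>A matrix records the runs from all states at level \<open>j\<close> at once: column
  \<open>s\<close> is the distribution after \<open>k\<close> further steps from \<open>s\<close>,
  whatever the prefix was.\<close>

primrec pobdd_suffix_mat ::
    "nat \<Rightarrow> 'a pobdd_scheme \<Rightarrow> (nat \<Rightarrow> bool) \<Rightarrow> nat \<Rightarrow> nat \<Rightarrow> real mat" where
  "pobdd_suffix_mat m P x j 0 = 1\<^sub>m m"
| "pobdd_suffix_mat m P x j (Suc k) =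
    pobdd_trans P (Suc (j + k)) (x (pobdd_order P (Suc (j + k)))) * pobdd_suffix_mat m P x j k"

lemma column_stochastic_suffix_mat:
  assumes "is_pobdd n m P" "j + k \<le> n"
  shows "column_stochastic_mat m (pobdd_suffix_mat m P x j k)"
  using assms(2)
proof (induction k)
  case (Suc k)
  then show ?case
    using assms(1) by (auto simp: is_pobdd_def intro!: column_stochastic_mult)
qed (simp add: column_stochastic_one)

lemma stochastic_pobdd_dist:
  assumes "is_pobdd n m P" "j \<le> n"
  shows "stochastic_vec m (pobdd_dist P x j)"
  using assms(2)
proof (induction j)
  case 0
  then show ?case using assms(1) by (simp add: is_pobdd_def)
next
  case (Suc j)
  then show ?case
    using assms(1) by (auto simp: is_pobdd_def intro!: stochastic_mult_mat_vec)
qed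

lemma pobdd_dist_add:
  assumes P: "is_pobdd n m P" and "j + k \<le> n"
  shows "pobdd_dist P x (j + k) = pobdd_suffix_mat m P x j k *\<^sub>v pobdd_dist P x j"
  using assms(2)
proof (induction k)
  case 0
  then show ?case
    using stochastic_pobdd_dist[OF P, of j x] by (simp add: stochastic_vec_def)
next
  case (Suc k)
  have "pobdd_trans P (Suc (j + k)) b \<in> carrier_mat m m" for b
    using P Suc.prems by (simp add: is_pobdd_def column_stochastic_mat_def)
  moreover have "pobdd_suffix_mat m P x j k \<in> carrier_mat m m"
    using column_stochastic_suffix_mat[OF P, of j k x] Suc.prems
    by (simp add: column_stochastic_mat_def)
  moreover have "pobdd_dist P x j \<in> carrier_vec m"
    using stochastic_pobdd_dist[OF P, of j x] Suc.prems by (simp add: stochastic_vec_def)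
  ultimately show ?case
    using Suc by (simp add: assoc_mult_mat_vec[of _ m m _ m])
qed

lemma pobdd_dist_cong:
  assumes "\<And>i. i \<in> {1..j} \<Longrightarrow> x (pobdd_order P i) = y (pobdd_order P i)"
  shows "pobdd_dist P x j = pobdd_dist P y j"
  using assms
proof (induction j)
  case (Suc j)
  have "pobdd_dist P x j = pobdd_dist P y j"
    by (rule Suc.IH) (simp add: Suc.prems)
  moreover have "x (pobdd_order P (Suc j)) = y (pobdd_order P (Suc j))"
    by (simp add: Suc.prems)
  ultimately show ?case by simp
qed simp

lemma pobdd_suffix_mat_cong:
  assumes "\<And>i. j < i \<Longrightarrow> x (pobdd_order P i) = y (pobdd_order P i)"
  shows "pobdd_suffix_mat m P x j k = pobdd_suffix_mat m P y j k"
proof (induction k)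
  case (Suc k)
  have "x (pobdd_order P (Suc (j + k))) = y (pobdd_order P (Suc (j + k)))"
    by (simp add: assms)
  then show ?case using Suc by simp
qed simp

text \<open>Markov property: given the state at level \<open>j\<close>, the outcome depends only on
  the suffix \<open>y\<close>.\<close>

lemma pobdd_prob_mix:
  assumes P: "is_pobdd n m P" and j: "j \<le> n" and A: "A \<subseteq> {..<m}"
  shows "pobdd_prob n P (mix (pobdd_order P) j x y) A = (\<Sum>s<m. vec_index (pobdd_dist P x j) s *
    (\<Sum>i\<in>A. pobdd_suffix_mat m P y j (n - j) $$ (i, s)))"
proof -
  let ?z = "mix (pobdd_order P) j x y"
  let ?M = "pobdd_suffix_mat m P y j (n - j)"
  have inj: "inj (pobdd_order P)"
    using P permutes_inj by (auto simp: is_pobdd_def)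
  have "pobdd_dist P ?z j = pobdd_dist P x j"
    by (rule pobdd_dist_cong) (auto simp: mix_def)
  moreover have "pobdd_suffix_mat m P ?z j (n - j) = ?M"
    \<comment> \<open>Injectivity of the order ensures that later steps read none of the variables
      fixed by \<open>x\<close>.\<close>
    by (rule pobdd_suffix_mat_cong) (simp add: mix_def inj_image_mem_iff[OF inj])
  ultimately have d: "pobdd_dist P ?z n = ?M *\<^sub>v pobdd_dist P x j"
    using pobdd_dist_add[OF P, of j "n - j" ?z] j by simp
  have M: "dim_row ?M = m" "dim_col ?M = m"
    using column_stochastic_suffix_mat[OF P, of j "n - j" y] j
    by (auto simp: column_stochastic_mat_def)
  have v: "dim_vec (pobdd_dist P x j) = m"
    using stochastic_pobdd_dist[OF P j, of x] by (auto simp: stochastic_vec_def)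
  have "pobdd_prob n P ?z A = (\<Sum>i\<in>A. \<Sum>s<m. ?M $$ (i, s) * vec_index (pobdd_dist P x j) s)"
    unfolding pobdd_prob_def d
  proof (rule sum.cong[OF refl])
    fix i assume "i \<in> A"
    then have "i < m" using A by auto
    then show "vec_index (?M *\<^sub>v pobdd_dist P x j) i =
        (\<Sum>s<m. ?M $$ (i, s) * vec_index (pobdd_dist P x j) s)"
      using M v by (simp add: scalar_prod_def lessThan_atLeast0)
  qed
  also have "\<dots> = (\<Sum>s<m. \<Sum>i\<in>A. ?M $$ (i, s) * vec_index (pobdd_dist P x j) s)"
    by (rule sum.swap)
  finally show ?thesis
    by (simp add: sum_distrib_left mult.commute)
qed

text \<open>The cardinality bound is applied to the subfunctions at level \<open>j\<close>; two
  distinct ones are separated by a suffix on which they differ, run on the program itself.\<close>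

lemma lv_subfunction_bound:
  assumes lv: "is_lv_pobdd n m P" and comp: "lv_computes n \<epsilon> P f"
    and eps: "0 \<le> \<epsilon>" and j: "j \<le> n"
  shows "real (card (subfunction n f (pobdd_order P) j ` bool_cube n)) powr (1 - \<epsilon>) \<le> m"
proof -
  let ?mix = "mix (pobdd_order P) j"
  let ?sub = "subfunction n f (pobdd_order P) j"
  let ?X = "?sub ` bool_cube n"
  have P: "is_pobdd n m P" using lv by (simp add: is_lv_pobdd_def)
  define out where "out v = (if v then lv_acc P else lv_rej P)" for v
  have out: "out v \<subseteq> {..<m}" for v
    using lv by (auto simp: is_lv_pobdd_def out_def)
  have correct: "pobdd_prob n P z (out (f z)) \<ge> 1 - \<epsilon>" "pobdd_prob n P z (out (\<not> f z)) = 0"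
    if "z \<in> bool_cube n" for z
    using comp that by (auto simp: lv_computes_def out_def)
  define rep where "rep a = (SOME x. x \<in> bool_cube n \<and> ?sub x = a)" for a
  have rep: "rep a \<in> bool_cube n" "?sub (rep a) = a" if "a \<in> ?X" for a
  proof -
    have "\<exists>x. x \<in> bool_cube n \<and> ?sub x = a" using that by blast
    from someI_ex[OF this] show "rep a \<in> bool_cube n" "?sub (rep a) = a"
      by (simp_all add: rep_def)
  qed
  define p where "p a s = vec_index (pobdd_dist P (rep a) j) s" for a s
  have p_nonneg: "0 \<le> p a s" if "s < m" for a s
    using stochastic_pobdd_dist[OF P j, of "rep a"] that by (simp add: stochastic_vec_def p_def)
  have p_sum: "(\<Sum>s<m. p a s) = 1" for a
    using stochastic_pobdd_dist[OF P j, of "rep a"] by (simp add: stochastic_vec_def p_def)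
  have "real (card ?X) powr (1 - \<epsilon>) \<le> card {..<m}"
  proof (rule las_vegas_card_bound[where p = p])
    show "finite ?X" "?X \<noteq> {}"
      using finite_bool_cube bool_cube_nonempty by auto
    show "finite {..<m}" "0 \<le> \<epsilon>" using eps by auto
    show "0 \<le> p a s" if "s \<in> {..<m}" for a s using p_nonneg that by simp
    show "(\<Sum>s\<in>{..<m}. p a s) = 1" for a by (rule p_sum)
    fix a b assume ab: "a \<in> ?X" "b \<in> ?X" "a \<noteq> b"
    then obtain y where y: "y \<in> bool_cube n" "(y \<in> a) \<noteq> (y \<in> b)"
      by (auto simp: subfunction_def)
    let ?M = "pobdd_suffix_mat m P y j (n - j)"
    \<comment> \<open>\<open>h v s\<close> is the probability of announcing \<open>v\<close> after
      reading the suffix \<open>y\<close> from state \<open>s\<close>.\<close>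
    define h where "h v s = (\<Sum>i\<in>out v. ?M $$ (i, s))" for v s
    have M: "column_stochastic_mat m ?M"
      using column_stochastic_suffix_mat[OF P, of j "n - j" y] j by simp
    have M0: "0 \<le> ?M $$ (i, s)" if "i < m" "s < m" for i s
      using M that by (auto simp: column_stochastic_mat_def stochastic_vec_def)
    have M1: "(\<Sum>i<m. ?M $$ (i, s)) = 1" if "s < m" for s
      using M that by (auto simp: column_stochastic_mat_def stochastic_vec_def)
    have h0: "0 \<le> h v s" if "s < m" for v s
      unfolding h_def using M0 out that by (intro sum_nonneg) blast
    have h1: "h v s \<le> 1" if "s < m" for v s
      unfolding h_def M1[OF that, symmetric] using M0 out that by (intro sum_mono2) auto
    have prob: "pobdd_prob n P (?mix (rep c) y) (out v) = (\<Sum>s<m. p c s * h v s)" for c v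
      unfolding pobdd_prob_mix[OF P j out] p_def h_def ..
    show "\<exists>g K. g a \<noteq> g b \<and> (\<forall>c\<in>?X. (\<Sum>s\<in>{s\<in>{..<m}. \<not> K (g c) s}. p c s) \<le> \<epsilon> \<and>
        (\<forall>s\<in>{..<m}. K (\<not> g c) s \<longrightarrow> p c s = 0))"
    proof (intro exI[of _ "\<lambda>c. y \<in> c"] exI[of _ "\<lambda>v s. h v s \<noteq> 0"] conjI ballI impI)
      show "(y \<in> a) \<noteq> (y \<in> b)" by fact
      fix c assume c: "c \<in> ?X"
      let ?z = "?mix (rep c) y"
      have z: "?z \<in> bool_cube n" using rep[OF c] y mix_in_bool_cube by blast
      have "y \<in> ?sub (rep c) \<longleftrightarrow> f ?z" using y by (simp add: subfunction_def)
      then have fz: "f ?z \<longleftrightarrow> y \<in> c" using rep[OF c] by simp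
      have ok: "1 - \<epsilon> \<le> (\<Sum>s<m. p c s * h (y \<in> c) s)"
        and wrong: "(\<Sum>s<m. p c s * h (y \<notin> c) s) = 0"
        using correct[OF z] by (simp_all add: prob fz)
      note ok
      \<comment> \<open>Only states able to announce the right answer contribute, each at most its
        mass; hence the remaining mass is at most \<open>\<epsilon>\<close>.\<close>
      also have "(\<Sum>s<m. p c s * h (y \<in> c) s) \<le> (\<Sum>s<m. if h (y \<in> c) s \<noteq> 0 then p c s else 0)"
        using p_nonneg h1 by (intro sum_mono) (auto intro: mult_left_le)
      also have "\<dots> = (\<Sum>s<m. p c s) - (\<Sum>s<m. if h (y \<in> c) s = 0 then p c s else 0)"
        unfolding sum_subtractf[symmetric] by (rule sum.cong) auto
      finally show "(\<Sum>s\<in>{s\<in>{..<m}. \<not> h (y \<in> c) s \<noteq> 0}. p c s) \<le> \<epsilon>"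
        using p_sum by (subst sum.inter_filter) simp_all
      fix s assume "s \<in> {..<m}" "h (y \<notin> c) s \<noteq> 0"
      \<comment> \<open>Zero error: a vanishing sum of nonnegative terms vanishes term by
        term.\<close>
      moreover have "\<forall>s\<in>{..<m}. p c s * h (y \<notin> c) s = 0"
        using wrong p_nonneg h0 by (subst (asm) sum_nonneg_eq_0_iff) auto
      ultimately show "p c s = 0" by auto
    qed
  qed
  then show ?thesis by simp
qed

text \<open>A deterministic run is a run through unit vectors, without neutral states. This
  guarantees that the minimum in \<open>LV_OBDD\<close> is attained.\<close>

lemma lv_pobdd_of_obdd:
  assumes B: "is_obdd n m B" and comp: "obdd_computes n B f" and eps: "0 \<le> \<epsilon>"
  shows "\<exists>P. is_lv_pobdd n m P \<and> lv_computes n \<epsilon> P f"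
proof -
  define T where "T j b = mat m m (\<lambda>(i, k). if i = obdd_trans B j b k then 1 else 0 :: real)" for j b
  define P where "P = \<lparr> pobdd_order = obdd_order B, pobdd_init = unit_vec m (obdd_init B),
    pobdd_trans = T, lv_acc = obdd_acc B, lv_rej = {..<m} - obdd_acc B, lv_neutral = {} \<rparr>"
  have trans: "obdd_trans B j b k < m" if "j \<in> {1..n}" "k < m" for j b k
    using B that by (fastforce simp: is_obdd_def Pi_iff)
  have col_T: "col (T j b) k = unit_vec m (obdd_trans B j b k)" if "k < m" for j b k
    using that by (auto simp: T_def unit_vec_def)
  have T: "column_stochastic_mat m (T j b)" if "j \<in> {1..n}" for j b
    using col_T stochastic_unit_vec trans[OF that]
    by (auto simp: column_stochastic_mat_def) (simp add: T_def)
  have acc: "obdd_acc B \<subseteq> {..<m}" and init: "obdd_init B < m"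
    using B by (auto simp: is_obdd_def)
  have "is_lv_pobdd n m P"
    using B T acc init
    by (auto simp: is_lv_pobdd_def is_pobdd_def P_def is_obdd_def stochastic_unit_vec)
  moreover have "lv_computes n \<epsilon> P f"
  proof -
    have dist: "obdd_state B x j < m \<and> pobdd_dist P x j = unit_vec m (obdd_state B x j)"
      if "j \<le> n" for x j
      using that
    proof (induction j)
      case 0
      then show ?case using init by (simp add: P_def)
    next
      case (Suc j)
      have "T (Suc j) b *\<^sub>v unit_vec m k = unit_vec m (obdd_trans B (Suc j) b k)" if "k < m" for b k
        using that trans[of "Suc j" k b] Suc.prems by (intro eq_vecI) (auto simp: T_def)
      then show ?case
        using Suc trans[of "Suc j"] by (simp add: P_def)
    qed
    have prob: "pobdd_prob n P x A = (if obdd_state B x n \<in> A then 1 else 0)"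
      if "A \<subseteq> {..<m}" for x A
    proof -
      have "pobdd_prob n P x A = (\<Sum>i\<in>A. if i = obdd_state B x n then 1 else 0)"
        unfolding pobdd_prob_def using dist[of n x] that by (intro sum.cong) auto
      then show ?thesis
        using finite_subset[OF that] by simp
    qed
    have out: "lv_acc P = obdd_acc B" "lv_rej P = {..<m} - obdd_acc B"
      by (simp_all add: P_def)
    have "pobdd_prob n P x (lv_acc P) = (if f x then 1 else 0)"
      "pobdd_prob n P x (lv_rej P) = (if f x then 0 else 1)" if "x \<in> bool_cube n" for x
      using comp that acc dist[of n x] by (auto simp: prob out obdd_computes_def)
    then show ?thesis
      using eps by (simp add: lv_computes_def)
  qed
  ultimately show ?thesis by blast
qed

section \<open>Comparison of the two minimum widths\<close>

theorem theorem1: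
  fixes n :: nat and f :: "(nat \<Rightarrow> bool) \<Rightarrow> bool" and \<epsilon> :: real
  assumes "0 \<le> \<epsilon>" and "\<epsilon> < 1"
  shows "real (OBDD n f) powr (1 - \<epsilon>) \<le> real (LV_OBDD n \<epsilon> f)"
proof -
  \<comment> \<open>The level with the most subfunctions gives the width of the whole program, so a
    bound for single levels suffices.\<close>
  have width: "\<exists>j\<le>n. \<exists>B. is_obdd n (card (subfunction n f \<pi> j ` bool_cube n)) B \<and>
      obdd_computes n B f" if \<pi>: "\<pi> permutes {1..n}" for \<pi>
  proof -
    let ?N = "\<lambda>j. card (subfunction n f \<pi> j ` bool_cube n)"
    have "Max (?N ` {..n}) \<in> ?N ` {..n}" by (rule Max_in) auto
    then obtain j where j: "j \<le> n" "Max (?N ` {..n}) = ?N j" by blast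
    have "?N i \<le> ?N j" if "i \<le> n" for i
      using Max_ge[of "?N ` {..n}" "?N i"] that j(2) by simp
    then show ?thesis
      using obdd_of_subfunctions[OF \<pi>] j(1) by blast
  qed
  have "\<exists>m P. is_lv_pobdd n m P \<and> lv_computes n \<epsilon> P f"
    using width[OF permutes_id] lv_pobdd_of_obdd[OF _ _ assms(1)] by blast
  from LeastI_ex[OF this] obtain P where P: "is_lv_pobdd n (LV_OBDD n \<epsilon> f) P"
    "lv_computes n \<epsilon> P f" by (auto simp: LV_OBDD_def)
  then have "pobdd_order P permutes {1..n}"
    by (simp add: is_lv_pobdd_def is_pobdd_def)
  \<comment> \<open>The deterministic program reads the variables in the order of \<open>P\<close>,
    so its width counts subfunctions that \<open>P\<close> must separate.\<close>
  then obtain j B where j: "j \<le> n"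
    and B: "is_obdd n (card (subfunction n f (pobdd_order P) j ` bool_cube n)) B"
      "obdd_computes n B f"
    using width by blast
  have "OBDD n f \<le> card (subfunction n f (pobdd_order P) j ` bool_cube n)"
    unfolding OBDD_def using B by (intro Least_le) blast
  then have "real (OBDD n f) powr (1 - \<epsilon>) \<le>
      real (card (subfunction n f (pobdd_order P) j ` bool_cube n)) powr (1 - \<epsilon>)"
    using assms(2) by (intro powr_mono2) auto
  also have "\<dots> \<le> LV_OBDD n \<epsilon> f"
    by (rule lv_subfunction_bound[OF P assms(1) j])
  finally show ?thesis .
qed

end
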